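(* Let $K$ be a field complete for a rank-one valuation $\operatorname{ord}$ of mixed characteristic $(0,p)$ with $\operatorname{ord}(p)=1$. Fix data $N\ge1$, a real number $0\le H<(p-1)/p^N$, and reals $U_1,\dots,U_g\ge0$ with $\sum_iU_i=H$. For $i=1,\dots,g$ let \[ f_i(X_1,\dots,X_g)=\sum_{j=1}^g\sum_{n=0}^\infty a_{n,ij}X_j^{p^n}\in K[[X_1,\dots,X_g]], \] and put $u_{n,ij}=\operatorname{ord}(a_{n,ij})\in\mathbb R\cup\{\infty\}$. Let $N_i$ be the largest integer with $\frac{p^{N_i}-1}{p-1}U_i<1$ ($N_i=\infty$ if $U_i=0$), and assume: (i) $u_{0,ii}=0$ for all $i$ and $u_{0,ij}=\infty$ for $i\ne j$; (ii) $u_{n,ii}=\frac{p^n-1}{p-1}U_i-n$ for $1\le n\le N_i$; (iii) $u_{n,ii}\ge 1-n$ for $n>N_i$; (iv) $u_{n,ij}\ge -n$ for all $i,j$ and $n\ge0$, and $u_{n,ij}\ge 1-n$ when $i>j$. Let $r=\frac1{p^N(p-1)}$ and $r'=\frac1{p^{N-1}(p-1)}-\frac H{p-1}$. Then \[ \bigcap_{i=1}^g\operatorname{Trop}(f_i)\cap\mathbb R^g_{>r}=\bigcap_{i=1}^g\operatorname{Trop}(f_i)\cap\mathbb R^g_{\ge r'}\quad\text{and}\quad \bigcap_{i=1}^g\operatorname{Trop}(f_i)\cap\mathbb R^g_{>1/(p-1)}=\emptyset. \]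
   Context: For a nonzero power series $f=\sum_\nu a_\nu X^\nu$ in $g$ variables converging on the open unit polydisc, its tropicalization $\operatorname{Trop}(f)$ is the set of $w\in\mathbb R^g_{>0}$ such that the minimum of $\operatorname{ord}(a_\nu)+\langle w,\nu\rangle$ over the monomials with $a_\nu\ne0$ is attained by at least two distinct exponents $\nu$. $\mathbb R^g_{>r}$ (resp. $\mathbb R^g_{\ge r'}$) denotes the set of vectors all of whose coordinates are $>r$ (resp. $\ge r'$). *)

theory Defs
  imports "HOL-Analysis.Analysis" "HOL-Computational_Algebra.Primes"
begin

text \<open>
  A valuation of rank one is written additively, with values in the reals together with
  infinity; rank one means that the value group is a nonzero subgroup of the reals.
  The characteristic of the residue field is described as usual by the natural
  numbers that vanish in it, i.e. that have positive valuation.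
\<close>

locale rank_one_valuation =
  fixes ord :: "'a::field \<Rightarrow> ereal"
  assumes ord_not_MInf: "ord x \<noteq> -\<infinity>"
    and ord_eq_PInf_iff: "ord x = \<infinity> \<longleftrightarrow> x = 0"
    and ord_mult: "ord (x * y) = ord x + ord y"
    and ord_add: "min (ord x) (ord y) \<le> ord (x + y)"
    and ord_nontrivial: "\<exists>x. x \<noteq> 0 \<and> ord x \<noteq> 0"

locale complete_rank_one_valuation = rank_one_valuation +
  assumes ord_complete:
    "(\<forall>M::real. \<exists>n0. \<forall>m\<ge>n0. \<forall>n\<ge>n0. ereal M < ord (s m - s n)) \<Longrightarrow>
      \<exists>l. ((\<lambda>n. ord (s n - l)) \<longlonglongrightarrow> \<infinity>)"

locale complete_mixed_char_valuation =
  complete_rank_one_valuation ord for ord :: "'a::field_char_0 \<Rightarrow> ereal" +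
  fixes p :: nat
  assumes prime_p: "prime p"
    and residue_char: "0 < ord (of_nat n) \<longleftrightarrow> p dvd n"
    and ord_p: "ord (of_nat p) = 1"

text \<open>
  A formal power series in the variables \<open>X\<^sub>i\<close>, with \<open>i\<close> ranging over the index type
  \<open>'g\<close>, is the family of its coefficients, indexed by exponents \<open>\<nu> :: 'g \<Rightarrow> nat\<close>.
\<close>

type_synonym ('a, 'g) mv_series = "('g \<Rightarrow> nat) \<Rightarrow> 'a"

definition Trop :: "('a::zero \<Rightarrow> ereal) \<Rightarrow> ('a, 'g::finite) mv_series \<Rightarrow> (real ^ 'g) set" where
  "Trop ord f = {w. (\<forall>i. 0 < w $ i) \<and>
     (\<exists>\<mu> \<nu>. \<mu> \<noteq> \<nu> \<and>
       (\<forall>\<kappa>\<in>{\<mu>, \<nu>}. is_arg_min (\<lambda>\<nu>. ord (f \<nu>) + ereal (\<Sum>i\<in>UNIV. w $ i * real (\<nu> i)))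
                              (\<lambda>\<nu>. f \<nu> \<noteq> 0) \<kappa>))}"

definition var_power :: "'g \<Rightarrow> nat \<Rightarrow> 'g \<Rightarrow> nat" where
  "var_power j m = (\<lambda>k. if k = j then m else 0)"

text \<open>
  The formal sum over \<open>j\<close> and \<open>n\<close> of \<open>c n j * X\<^sub>j ^ (p ^ n)\<close>.  For \<open>p \<ge> 2\<close> the inner sum
  below has at most one term.
\<close>

definition p_power_series :: "nat \<Rightarrow> (nat \<Rightarrow> 'g \<Rightarrow> 'a) \<Rightarrow> ('a::comm_monoid_add, 'g::finite) mv_series" where
  "p_power_series p c = (\<lambda>\<nu>. \<Sum>j\<in>UNIV. \<Sum>n | \<nu> = var_power j (p ^ n). c n j)"

lemma p_power_series_var_power:
  assumes "p \<ge> 2"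
  shows "p_power_series p c (var_power j (p ^ n)) = c n j"
proof -
  have "var_power j (p ^ n) = var_power k (p ^ m) \<longleftrightarrow> k = j \<and> m = n" for k m
    using assms by (auto simp: var_power_def fun_eq_iff split: if_splits)
  then have "{m. var_power j (p ^ n) = var_power k (p ^ m)} = (if k = j then {n} else {})" for k
    by auto
  then have "p_power_series p c (var_power j (p ^ n)) = (\<Sum>k\<in>UNIV. if k = j then c n k else 0)"
    unfolding p_power_series_def by (intro sum.cong) auto
  then show ?thesis by simp
qed

lemma p_power_series_eq_0:
  assumes "\<And>j n. \<nu> \<noteq> var_power j (p ^ n)"
  shows "p_power_series p c \<nu> = 0"
  using assms by (simp add: p_power_series_def)

definition max_level :: "nat \<Rightarrow> real \<Rightarrow> enat" where
  "max_level p U = (if U = 0 then \<infinity>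
     else enat (GREATEST n. (real p ^ n - 1) / (real p - 1) * U < 1))"

end

theory Submission
  imports Defs
begin

text \<open>
  At a point with \<open>ord X\<^sub>j = x\<close> the term \<open>X\<^sub>j^(p^n) / p^n\<close> of the logarithm has order
  \<open>p^n x - n\<close>, which is minimal exactly at \<open>n = N\<close> if \<open>x\<close> lies strictly between
  \<open>r = 1 / (p^N (p - 1))\<close> and \<open>1 / (p^(N-1) (p - 1))\<close>.  Suppose that the least coordinate \<open>m\<close> of
  a common tropical point \<open>w\<close> satisfies \<open>r < m < r'\<close>, and consider the indices \<open>i\<close> with
  \<open>w\<^sub>i \<le> m + (p^N - 1) / (p^N (p - 1)) * (\<Sum>j<i. U\<^sub>j)\<close>; an index where \<open>m\<close> is attained is one of
  them.  For such an \<open>i\<close> the monomial \<open>X\<^sub>i^(p^N)\<close> strictly beats all other powers of \<open>X\<^sub>i\<close> in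
  \<open>f\<^sub>i\<close>, so some power of \<open>X\<^sub>j\<close> with \<open>j \<noteq> i\<close> does at least as well.  The extra \<open>1\<close> in
  the bound for \<open>i > j\<close> excludes \<open>j < i\<close>, and if \<open>j > i\<close> then \<open>j\<close> is again such an index.  This
  contradicts the finiteness of the index set.
\<close>

text \<open>The order of \<open>X^(q^n) / q^n\<close> at \<open>ord X = x\<close>, normalized by \<open>ord q = 1\<close>.\<close>

definition log_weight :: "real \<Rightarrow> nat \<Rightarrow> real \<Rightarrow> real" where
  "log_weight q n x = q ^ n * x - real n"

text \<open>The abscissa at which the lines \<open>log_weight q n\<close> and \<open>log_weight q (Suc n)\<close> cross.\<close>

definition breakpoint :: "real \<Rightarrow> nat \<Rightarrow> real" where
  "breakpoint q n = 1 / (q ^ n * (q - 1))"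

lemma breakpoint_antimono:
  assumes "1 < q" "m \<le> n"
  shows "breakpoint q n \<le> breakpoint q m"
  unfolding breakpoint_def using assms
  by (intro divide_left_mono mult_right_mono power_increasing mult_pos_pos) auto

lemma log_weight_less_Suc_iff:
  assumes "1 < q"
  shows "log_weight q n x < log_weight q (Suc n) x \<longleftrightarrow> breakpoint q n < x"
  using assms by (simp add: breakpoint_def log_weight_def field_simps)

lemma log_weight_Suc_less_iff:
  assumes "1 < q"
  shows "log_weight q (Suc n) x < log_weight q n x \<longleftrightarrow> x < breakpoint q n"
  using assms by (simp add: breakpoint_def log_weight_def field_simps)

lemma log_weight_le_cancel_iff:
  "1 < q \<Longrightarrow> log_weight q n x \<le> log_weight q n y \<longleftrightarrow> x \<le> y"
  by (simp add: log_weight_def)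

lemma log_weight_less_if_breakpoint_less:
  assumes "1 < q" "breakpoint q N < x" "N < n"
  shows "log_weight q N x < log_weight q n x"
proof -
  have increase: "log_weight q k x < log_weight q (Suc k) x" if "N \<le> k" for k
    using breakpoint_antimono[OF assms(1) that] assms by (simp add: log_weight_less_Suc_iff)
  from \<open>N < n\<close> have "Suc N \<le> n" by simp
  then show ?thesis
  proof (induction n rule: dec_induct)
    case base
    show ?case by (simp add: increase)
  next
    case (step k)
    then show ?case using increase[of k] by simp
  qed
qed

lemma log_weight_less_if_less_breakpoint:
  assumes "1 < q" "x < breakpoint q N" "n \<le> N"
  shows "log_weight q (Suc N) x < log_weight q n x"
  using \<open>n \<le> N\<close>
proof (induction n rule: inc_induct)
  case base
  show ?case using assms by (simp add: log_weight_Suc_less_iff)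
next
  case (step k)
  have "x < breakpoint q k"
    using breakpoint_antimono[of q k N] assms step.hyps by simp
  then have "log_weight q (Suc k) x < log_weight q k x"
    using assms(1) by (simp add: log_weight_Suc_less_iff)
  with step.IH show ?case by simp
qed

lemma log_weight_unique_min:
  assumes "1 < q" "breakpoint q (Suc N) < x" "x < breakpoint q N" "n \<noteq> Suc N"
  shows "log_weight q (Suc N) x < log_weight q n x"
  using assms log_weight_less_if_breakpoint_less log_weight_less_if_less_breakpoint
  by (cases "n \<le> N") auto

lemma log_weight_min:
  assumes "1 < q" "breakpoint q (Suc N) < x" "x < breakpoint q N" "x \<le> y"
  shows "log_weight q (Suc N) x \<le> log_weight q n y"
proof -
  have "log_weight q (Suc N) x \<le> log_weight q n x"
    using log_weight_unique_min[OF assms(1-3), of n] by (cases "n = Suc N") auto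
  also have "\<dots> \<le> log_weight q n y"
    using assms by (simp add: log_weight_le_cancel_iff)
  finally show ?thesis .
qed

definition q_number :: "real \<Rightarrow> nat \<Rightarrow> real" where
  "q_number q n = (q ^ n - 1) / (q - 1)"

lemma q_number_nonneg: "1 < q \<Longrightarrow> 0 \<le> q_number q n"
  by (simp add: q_number_def)

lemma q_number_le: "1 < q \<Longrightarrow> q_number q n \<le> q ^ n / (q - 1)"
  by (simp add: q_number_def divide_right_mono)

lemma q_number_ge:
  assumes "2 \<le> q"
  shows "real n \<le> q_number q n"
proof -
  have "real n * 1 \<le> real n * (q - 1)"
    using assms by (intro mult_left_mono) auto
  moreover have "1 + real n * (q - 1) \<le> q ^ n"
    using Bernoulli_inequality[of "q - 1" n] assms by simp
  ultimately show ?thesis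
    using assms by (simp add: q_number_def field_simps)
qed

text \<open>
  Coefficients of order \<open>q_number q n * u - n\<close> behave like those of the logarithm at a point shifted
  by \<open>u / (q - 1)\<close>.
\<close>

lemma log_weight_add_divide:
  "log_weight q n (x + u / (q - 1)) = q_number q n * u + log_weight q n x + u / (q - 1)"
  by (simp add: log_weight_def q_number_def diff_divide_distrib algebra_simps)

lemma breakpoint_Suc_add_less_iff:
  assumes "1 < q"
  shows "breakpoint q (Suc N) + u / (q - 1) < breakpoint q N \<longleftrightarrow> u < (q - 1) / q ^ Suc N"
proof -
  have "breakpoint q N - breakpoint q (Suc N) = 1 / q ^ Suc N"
    using assms by (simp add: breakpoint_def divide_simps)
  then have "breakpoint q (Suc N) + u / (q - 1) < breakpoint q N \<longleftrightarrow> u / (q - 1) < 1 / q ^ Suc N"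
    by linarith
  also have "\<dots> \<longleftrightarrow> u < (q - 1) / q ^ Suc N"
    using assms by (simp add: field_simps)
  finally show ?thesis .
qed

lemma q_number_mult_less_1:
  assumes "1 < q" "0 \<le> u" "breakpoint q (Suc N) + u / (q - 1) < breakpoint q N"
  shows "q_number q (Suc N) * u < 1"
proof -
  have "u < (q - 1) / q ^ Suc N"
    using assms by (simp only: breakpoint_Suc_add_less_iff)
  have "q_number q (Suc N) * u \<le> q ^ Suc N / (q - 1) * u"
    using assms by (intro mult_right_mono q_number_le) auto
  also have "\<dots> < 1"
    using \<open>u < (q - 1) / q ^ Suc N\<close> assms(1) by (simp add: field_simps)
  finally show ?thesis .
qed

lemma le_max_level:
  assumes "2 \<le> p" "0 \<le> U" "q_number p n * U < 1"
  shows "enat n \<le> max_level p U"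
proof (cases "U = 0")
  case True
  then show ?thesis by (simp add: max_level_def)
next
  case False
  have "m \<le> nat \<lceil>1 / U\<rceil>" if "q_number p m * U < 1" for m
  proof -
    have "real m * U \<le> q_number p m * U"
      using q_number_ge[of "real p" m] assms by (intro mult_right_mono) auto
    also note that
    finally have "real m < 1 / U"
      using False assms by (simp add: field_simps)
    then show ?thesis by linarith
  qed
  then have "n \<le> (GREATEST n. q_number p n * U < 1)"
    using assms(3) by (intro Greatest_le_nat) auto
  then show ?thesis
    using False by (simp add: max_level_def q_number_def)
qed

lemma sum_mult_var_power:
  fixes x :: "'g::finite \<Rightarrow> real"
  shows "(\<Sum>i\<in>UNIV. x i * real (var_power j m i)) = real m * x j"
proof -
  have "(\<Sum>i\<in>UNIV. x i * real (var_power j m i)) = (\<Sum>i\<in>UNIV. if i = j then real m * x j else 0)"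
    by (intro sum.cong) (auto simp: var_power_def)
  then show ?thesis by simp
qed

lemma Trop_p_power_series_competitor:
  fixes c :: "nat \<Rightarrow> 'g::finite \<Rightarrow> 'a::comm_monoid_add"
  assumes "2 \<le> p" "w \<in> Trop ord (p_power_series p c)" "c k l \<noteq> 0"
  obtains n j where "(n, j) \<noteq> (k, l)" and "c n j \<noteq> 0"
    and "ord (c n j) + ereal (real p ^ n * w $ j) \<le> ord (c k l) + ereal (real p ^ k * w $ l)"
proof -
  let ?f = "p_power_series p c"
  let ?weight = "\<lambda>\<nu>. ord (?f \<nu>) + ereal (\<Sum>i\<in>UNIV. w $ i * real (\<nu> i))"
  define minimal where "minimal = is_arg_min ?weight (\<lambda>\<nu>. ?f \<nu> \<noteq> 0)"
  note coeff = p_power_series_var_power[OF assms(1)]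
  have weight: "?weight (var_power j (p ^ n)) = ord (c n j) + ereal (real p ^ n * w $ j)" for j n
    by (simp add: coeff sum_mult_var_power)
  obtain \<mu> \<nu> where "\<mu> \<noteq> \<nu>" "minimal \<mu>" "minimal \<nu>"
    using assms(2) unfolding Trop_def minimal_def by blast
  then obtain \<kappa> where \<kappa>: "\<kappa> \<noteq> var_power l (p ^ k)" "minimal \<kappa>"
    by metis
  then have "?f \<kappa> \<noteq> 0"
    by (simp add: minimal_def is_arg_min_def)
  then obtain j n where \<kappa>_eq: "\<kappa> = var_power j (p ^ n)"
    using p_power_series_eq_0 by metis
  have "?f (var_power l (p ^ k)) \<noteq> 0"
    using assms(3) by (simp add: coeff)
  then have "?weight \<kappa> \<le> ?weight (var_power l (p ^ k))"
    using \<kappa>(2) unfolding minimal_def is_arg_min_linorder by blast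
  then have "ord (c n j) + ereal (real p ^ n * w $ j) \<le> ord (c k l) + ereal (real p ^ k * w $ l)"
    unfolding \<kappa>_eq weight .
  moreover have "(n, j) \<noteq> (k, l)" "c n j \<noteq> 0"
    using \<kappa>(1) \<open>?f \<kappa> \<noteq> 0\<close> by (auto simp: \<kappa>_eq coeff)
  ultimately show thesis
    using that by blast
qed

lemma vec_min_coordinate:
  fixes w :: "'b::linorder ^ 'g::finite"
  obtains i where "\<And>j. w $ i \<le> w $ j"
  using ex_is_arg_min_if_finite[of UNIV "($) w"] by (auto simp: is_arg_min_linorder)

locale log_type_system = rank_one_valuation ord
  for ord :: "'a::field \<Rightarrow> ereal" +
  fixes p :: nat and a :: "nat \<Rightarrow> 'g::finite \<Rightarrow> 'g \<Rightarrow> 'a"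
  assumes p_ge_2: "2 \<le> p"
    and ord_linear_diag: "ord (a 0 i i) = 0"
    and ord_linear_offdiag: "i \<noteq> j \<Longrightarrow> ord (a 0 i j) = \<infinity>"
    and ord_ge: "ereal (- real n) \<le> ord (a n i j)"
begin

definition tropical_prevariety :: "(real ^ 'g) set" where
  "tropical_prevariety = (\<Inter>i. Trop ord (p_power_series p (\<lambda>n j. a n i j)))"

lemma p_gt_1: "1 < real p"
  using p_ge_2 by simp

lemma tropical_prevariety_competitor:
  assumes "w \<in> tropical_prevariety" "ord (a k i i) = ereal u"
  obtains n j v where "(n, j) \<noteq> (k, i)" and "ord (a n i j) = ereal v"
    and "v + real p ^ n * w $ j \<le> u + real p ^ k * w $ i"
proof -
  have "w \<in> Trop ord (p_power_series p (\<lambda>n j. a n i j))"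
    using assms(1) by (auto simp: tropical_prevariety_def)
  moreover have "a k i i \<noteq> 0"
    using assms(2) ord_eq_PInf_iff[of "a k i i"] by auto
  ultimately obtain n j where "(n, j) \<noteq> (k, i)" "a n i j \<noteq> 0"
    and "ord (a n i j) + ereal (real p ^ n * w $ j) \<le> ord (a k i i) + ereal (real p ^ k * w $ i)"
    using Trop_p_power_series_competitor[OF p_ge_2, of w ord "\<lambda>n j. a n i j" k i] by metis
  moreover obtain v where "ord (a n i j) = ereal v"
    using \<open>a n i j \<noteq> 0\<close> ord_eq_PInf_iff ord_not_MInf by (cases "ord (a n i j)") auto
  ultimately show thesis
    using assms(2) by (intro that[of n j v]) auto
qed

theorem tropical_prevariety_bounded:
  assumes "w \<in> tropical_prevariety"
  shows "\<exists>i. w $ i \<le> breakpoint p 0"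
proof (rule ccontr)
  assume "\<nexists>i. w $ i \<le> breakpoint p 0"
  then have large: "breakpoint p 0 < w $ i" for i
    by (simp add: not_le)
  obtain i where i_min: "\<And>j. w $ i \<le> w $ j"
    using vec_min_coordinate by blast
  have "ord (a 0 i i) = ereal 0"
    by (simp add: ord_linear_diag zero_ereal_def)
  with assms obtain n j v where competitor: "(n, j) \<noteq> (0, i)" "ord (a n i j) = ereal v"
    "v + real p ^ n * w $ j \<le> 0 + real p ^ 0 * w $ i"
    by (rule tropical_prevariety_competitor)
  have "0 < n"
    using competitor(1,2) ord_linear_offdiag[of i j] by (cases n) auto
  have "log_weight p 0 (w $ i) < log_weight p n (w $ i)"
    using log_weight_less_if_breakpoint_less[OF p_gt_1 large \<open>0 < n\<close>] .
  also have "\<dots> \<le> log_weight p n (w $ j)"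
    using i_min by (simp add: log_weight_le_cancel_iff[OF p_gt_1])
  also have "\<dots> \<le> v + real p ^ n * w $ j"
    using ord_ge[of n i j] competitor(2) by (simp add: log_weight_def)
  finally show False
    using competitor(3) by (simp add: log_weight_def)
qed

end

locale triangular_log_type_system = log_type_system ord p a
  for ord :: "'a::field \<Rightarrow> ereal" and p
    and a :: "nat \<Rightarrow> 'g::{finite,linorder} \<Rightarrow> 'g \<Rightarrow> 'a" +
  fixes U :: "'g \<Rightarrow> real"
  assumes U_nonneg: "0 \<le> U i"
    and ord_diag_le_level: "1 \<le> n \<Longrightarrow> enat n \<le> max_level p (U i) \<Longrightarrow>
      ord (a n i i) = ereal (q_number p n * U i - real n)"
    and ord_diag_gt_level: "max_level p (U i) < enat n \<Longrightarrow> ereal (1 - real n) \<le> ord (a n i i)"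
    and ord_below_diag: "j < i \<Longrightarrow> ereal (1 - real n) \<le> ord (a n i j)"
begin

lemma sum_U_mono: "I \<subseteq> J \<Longrightarrow> sum U I \<le> sum U J"
  by (intro sum_mono2) (auto simp: U_nonneg)

lemma ord_diag:
  assumes "enat n \<le> max_level p (U i)"
  shows "ord (a n i i) = ereal (q_number p n * U i - real n)"
  using assms ord_diag_le_level[of n i]
  by (cases n) (auto simp: ord_linear_diag q_number_def)

lemma ord_diag_Suc:
  assumes "breakpoint p (Suc N) + U i / (real p - 1) < breakpoint p N"
  shows "ord (a (Suc N) i i) = ereal (q_number p (Suc N) * U i - real (Suc N))"
  by (intro ord_diag le_max_level q_number_mult_less_1 p_ge_2 p_gt_1 U_nonneg assms)

lemma diagonal_term_less:
  assumes "breakpoint p (Suc N) < x" "x + U i / (real p - 1) < breakpoint p N"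
    and "n \<noteq> Suc N" "ord (a n i i) = ereal v"
  shows "q_number p (Suc N) * U i + log_weight p (Suc N) x < v + real p ^ n * x"
proof (cases "max_level p (U i) < enat n")
  case True
  have "0 \<le> U i / (real p - 1)"
    using U_nonneg p_gt_1 by simp
  then have "log_weight p (Suc N) x < log_weight p n x"
    using assms p_gt_1 by (intro log_weight_unique_min) auto
  moreover have "q_number p (Suc N) * U i < 1"
    using assms U_nonneg by (intro q_number_mult_less_1 p_gt_1) auto
  moreover have "1 - real n \<le> v"
    using ord_diag_gt_level[OF True] assms(4) by simp
  ultimately show ?thesis
    by (simp add: log_weight_def)
next
  case False
  then have "v = q_number p n * U i - real n"
    using ord_diag[of n i] assms(4) by simp
  moreover have "0 \<le> U i / (real p - 1)"
    using U_nonneg p_gt_1 by simp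
  then have "log_weight p (Suc N) (x + U i / (real p - 1)) < log_weight p n (x + U i / (real p - 1))"
    using assms p_gt_1 by (intro log_weight_unique_min) auto
  then have "q_number p (Suc N) * U i + log_weight p (Suc N) x
      < q_number p n * U i + log_weight p n x"
    unfolding log_weight_add_divide by simp
  ultimately show ?thesis
    by (simp add: log_weight_def)
qed

definition threshold :: "nat \<Rightarrow> real \<Rightarrow> 'g set \<Rightarrow> real" where
  "threshold n m J = m + q_number p n / real p ^ n * sum U J"

lemma log_weight_threshold:
  "log_weight p n (threshold n m J) = log_weight p n m + q_number p n * sum U J"
  using p_gt_1 by (simp add: log_weight_def threshold_def algebra_simps)

lemma log_weight_threshold_less:
  assumes "breakpoint p (Suc N) < m" "m + sum U J / (real p - 1) < breakpoint p N" "m \<le> x"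
  shows "log_weight p (Suc N) (threshold (Suc N) m J) < log_weight p n x + 1"
proof -
  have "0 \<le> sum U J / (real p - 1)"
    using p_gt_1 by (intro divide_nonneg_nonneg sum_nonneg U_nonneg) auto
  then have "log_weight p (Suc N) m \<le> log_weight p n x"
    using assms by (intro log_weight_min p_gt_1) auto
  moreover have "q_number p (Suc N) * sum U J < 1"
    using assms by (intro q_number_mult_less_1 sum_nonneg U_nonneg p_gt_1) auto
  ultimately show ?thesis
    unfolding log_weight_threshold by simp
qed

lemma threshold_mono: "I \<subseteq> J \<Longrightarrow> threshold n m I \<le> threshold n m J"
  unfolding threshold_def
  by (intro add_left_mono mult_left_mono sum_U_mono divide_nonneg_nonneg q_number_nonneg p_gt_1) auto

lemma threshold_ge: "m \<le> threshold n m J"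
  using threshold_mono[of "{}" J n m] by (simp add: threshold_def)

lemma threshold_le: "threshold n m J \<le> m + sum U J / (real p - 1)"
proof -
  have "q_number p n / real p ^ n \<le> 1 / (real p - 1)"
    using q_number_le[OF p_gt_1, of n] p_gt_1 by (simp add: field_simps)
  then have "q_number p n / real p ^ n * sum U J \<le> 1 / (real p - 1) * sum U J"
    by (intro mult_right_mono) (auto simp: sum_nonneg U_nonneg)
  then show ?thesis by (simp add: threshold_def)
qed

lemma sum_U_atMost: "sum U {..i} = U i + sum U {..<i}"
  by (simp flip: ivl_disj_un(2))

lemma competitor_le_log_weight_threshold:
  assumes "w \<in> tropical_prevariety" "breakpoint p (Suc N) < w $ i"
    and "w $ i + U i / (real p - 1) < breakpoint p N"
    and "w $ i \<le> threshold (Suc N) m {..<i}"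
  obtains n j v where "j \<noteq> i" and "ord (a n i j) = ereal v"
    and "v + real p ^ n * w $ j \<le> log_weight p (Suc N) (threshold (Suc N) m {..i})"
proof -
  have "breakpoint p (Suc N) + U i / (real p - 1) < breakpoint p N"
    using assms(2,3) by simp
  with assms(1) obtain n j v where competitor: "(n, j) \<noteq> (Suc N, i)" "ord (a n i j) = ereal v"
    and le: "v + real p ^ n * w $ j
      \<le> q_number p (Suc N) * U i - real (Suc N) + real p ^ Suc N * w $ i"
    by (rule tropical_prevariety_competitor[OF _ ord_diag_Suc])
  have "log_weight p (Suc N) (w $ i) \<le> log_weight p (Suc N) (threshold (Suc N) m {..<i})"
    using assms(4) by (simp add: log_weight_le_cancel_iff[OF p_gt_1])
  then have "v + real p ^ n * w $ j \<le> log_weight p (Suc N) (threshold (Suc N) m {..i})"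
    using le unfolding log_weight_threshold sum_U_atMost
    by (simp add: log_weight_def distrib_left)
  moreover have "j \<noteq> i"
    using diagonal_term_less[OF assms(2,3), of n v] competitor le
    by (auto simp: log_weight_def)
  ultimately show thesis
    using that competitor(2) by blast
qed

lemma exists_later_coordinate_le_threshold:
  assumes w: "w \<in> tropical_prevariety" and m_le: "\<And>j. m \<le> w $ j"
    and m_bounds: "breakpoint p (Suc N) < m" "m + sum U UNIV / (real p - 1) < breakpoint p N"
    and below: "w $ i \<le> threshold (Suc N) m {..<i}"
  obtains j where "i < j" "w $ j \<le> threshold (Suc N) m {..<j}"
proof -
  define t where "t = threshold (Suc N) m {..i}"
  have sum_le: "m + sum U {..i} / (real p - 1) \<le> m + sum U UNIV / (real p - 1)"
    using sum_U_mono[of "{..i}" UNIV] p_gt_1 by (simp add: divide_right_mono)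
  have t_bounds: "m \<le> t" "t < breakpoint p N"
    using threshold_ge threshold_le[of "Suc N" m "{..i}"] sum_le m_bounds(2) by (auto simp: t_def)
  have "w $ i + U i / (real p - 1) \<le> m + sum U {..i} / (real p - 1)"
    using below threshold_le[of "Suc N" m "{..<i}"] by (simp add: sum_U_atMost add_divide_distrib)
  then have "breakpoint p (Suc N) < w $ i" "w $ i + U i / (real p - 1) < breakpoint p N"
    using m_le[of i] m_bounds sum_le by linarith+
  with w obtain n j v where "j \<noteq> i" and ord_v: "ord (a n i j) = ereal v"
    and le: "v + real p ^ n * w $ j \<le> log_weight p (Suc N) t"
    unfolding t_def by (rule competitor_le_log_weight_threshold[OF _ _ _ below])
  have "\<not> j < i"
  proof
    assume "j < i"
    have "log_weight p (Suc N) t < log_weight p n (w $ j) + 1"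
      unfolding t_def using m_bounds sum_le m_le by (intro log_weight_threshold_less) auto
    then show False
      using le ord_below_diag[OF \<open>j < i\<close>, of n] ord_v by (simp add: log_weight_def)
  qed
  with \<open>j \<noteq> i\<close> have "i < j" by simp
  have "log_weight p n (w $ j) \<le> v + real p ^ n * w $ j"
    using ord_ge[of n i j] ord_v by (simp add: log_weight_def)
  also note le
  also have "log_weight p (Suc N) t \<le> log_weight p n t"
    using m_bounds t_bounds by (intro log_weight_min p_gt_1) auto
  finally have "w $ j \<le> t"
    by (simp add: log_weight_le_cancel_iff[OF p_gt_1])
  also have "t \<le> threshold (Suc N) m {..<j}"
    unfolding t_def using \<open>i < j\<close> by (intro threshold_mono) auto
  finally show thesis
    using that \<open>i < j\<close> by blast
qed

theorem tropical_prevariety_gap: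
  assumes w: "w \<in> tropical_prevariety" and large: "\<And>i. breakpoint p (Suc N) < w $ i"
  shows "breakpoint p N - sum U UNIV / (real p - 1) \<le> w $ i"
proof (rule ccontr)
  assume "\<not> breakpoint p N - sum U UNIV / (real p - 1) \<le> w $ i"
  moreover obtain k where k_min: "\<And>j. w $ k \<le> w $ j"
    using vec_min_coordinate by blast
  ultimately have gap: "w $ k + sum U UNIV / (real p - 1) < breakpoint p N"
    using k_min[of i] by linarith
  define S where "S = {i. w $ i \<le> threshold (Suc N) (w $ k) {..<i}}"
  have "k \<in> S"
    using threshold_ge by (simp add: S_def)
  then have "Max S \<in> S"
    by (intro Max_in) auto
  then obtain j where "Max S < j" "j \<in> S"
    using exists_later_coordinate_le_threshold[OF w k_min large gap, of "Max S"] by (auto simp: S_def)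
  then show False
    using Max_ge[of S j] by (simp flip: not_le)
qed

end

theorem theorem9p10:
  fixes ord :: "'a::field_char_0 \<Rightarrow> ereal"
    and p N :: nat
    and H r r' :: real
    and U :: "'g::{finite,linorder} \<Rightarrow> real"
    and a :: "nat \<Rightarrow> 'g \<Rightarrow> 'g \<Rightarrow> 'a"
    and f :: "'g \<Rightarrow> ('a, 'g) mv_series"
  assumes "complete_mixed_char_valuation ord p"
    and "1 \<le> N"
    and "0 \<le> H" and "H < (real p - 1) / real p ^ N"
    and "\<forall>i. 0 \<le> U i" and "(\<Sum>i\<in>UNIV. U i) = H"
    and "\<forall>i. f i = p_power_series p (\<lambda>n j. a n i j)"
    and "\<forall>i. ord (a 0 i i) = 0"
    and "\<forall>i j. i \<noteq> j \<longrightarrow> ord (a 0 i j) = \<infinity>"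
    and "\<forall>i n. 1 \<le> n \<and> enat n \<le> max_level p (U i) \<longrightarrow>
           ord (a n i i) = ereal ((real p ^ n - 1) / (real p - 1) * U i - real n)"
    and "\<forall>i n. max_level p (U i) < enat n \<longrightarrow> ereal (1 - real n) \<le> ord (a n i i)"
    and "\<forall>i j n. ereal (- real n) \<le> ord (a n i j)"
    and "\<forall>i j n. i > j \<longrightarrow> ereal (1 - real n) \<le> ord (a n i j)"
    and "r = 1 / (real p ^ N * (real p - 1))"
    and "r' = 1 / (real p ^ (N - 1) * (real p - 1)) - H / (real p - 1)"
  shows "(\<Inter>i. Trop ord (f i)) \<inter> {w. \<forall>i. w $ i > r} = (\<Inter>i. Trop ord (f i)) \<inter> {w. \<forall>i. w $ i \<ge> r'} \<and>
         (\<Inter>i. Trop ord (f i)) \<inter> {w. \<forall>i. w $ i > 1 / (real p - 1)} = {}"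
proof -
  interpret complete_mixed_char_valuation ord p by fact
  interpret triangular_log_type_system ord p a U
    using prime_ge_2_nat[OF prime_p] assms(5,8-13) by unfold_locales (simp_all add: q_number_def)
  have prevariety: "(\<Inter>i. Trop ord (f i)) = tropical_prevariety"
    using assms(7) by (simp add: tropical_prevariety_def)
  obtain M where N_eq: "N = Suc M"
    using \<open>1 \<le> N\<close> by (cases N) auto
  have r_eq: "r = breakpoint p (Suc M)" and r'_eq: "r' = breakpoint p M - sum U UNIV / (real p - 1)"
    using assms(6,14,15) by (simp_all add: N_eq breakpoint_def)
  have "r < r'"
    using breakpoint_Suc_add_less_iff[OF p_gt_1, of M H] assms(4,6) unfolding r_eq r'_eq N_eq by simp
  moreover have "r' \<le> w $ i" if "w \<in> tropical_prevariety" "\<forall>i. r < w $ i" for w i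
    using that tropical_prevariety_gap unfolding r_eq r'_eq by blast
  ultimately have "tropical_prevariety \<inter> {w. \<forall>i. w $ i > r} =
      tropical_prevariety \<inter> {w. \<forall>i. w $ i \<ge> r'}"
    by (auto intro: less_le_trans)
  moreover have "tropical_prevariety \<inter> {w. \<forall>i. w $ i > 1 / (real p - 1)} = {}"
    using tropical_prevariety_bounded by (force simp: breakpoint_def simp flip: not_less)
  ultimately show ?thesis
    unfolding prevariety ..
qed

end
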